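(* Let $m'_n$ denote the number of matroids on the ground set $[n]=\{1,\dots,n\}$ that have no loops and no coloops, and let $s_n$ denote the number of sparse paving matroids on $[n]$. Then $$\log m'_n \le (1+o(1))\log s_n \qquad\text{as } n\to\infty.$$
   Context: A matroid $M$ is paving if every circuit of $M$ has cardinality at least $r(M)$; $M$ is sparse paving if both $M$ and its dual are paving. Matroids are counted as distinct set systems on the fixed labelled ground set $[n]$. $\log$ denotes the base-2 logarithm. *)

theory Defs
  imports Complex_Main "HOL-Library.Landau_Symbols"
begin

text \<open>A matroid is given by its finite ground set and its family of independent sets.\<close>

locale matroid =
  fixes E :: "'a set" and Ind :: "'a set set"
  assumes finite_ground: "finite E"
    and indep_subset_ground: "X \<in> Ind \<Longrightarrow> X \<subseteq> E"
    and indep_empty: "{} \<in> Ind"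
    and indep_subset: "X \<in> Ind \<Longrightarrow> Y \<subseteq> X \<Longrightarrow> Y \<in> Ind"
    and augment: "X \<in> Ind \<Longrightarrow> Y \<in> Ind \<Longrightarrow> card X < card Y \<Longrightarrow> \<exists>y\<in>Y - X. insert y X \<in> Ind"

definition is_basis :: "'a set set \<Rightarrow> 'a set \<Rightarrow> bool" where
  "is_basis Ind B \<longleftrightarrow> B \<in> Ind \<and> (\<forall>X\<in>Ind. B \<subseteq> X \<longrightarrow> X = B)"

definition is_circuit :: "'a set \<Rightarrow> 'a set set \<Rightarrow> 'a set \<Rightarrow> bool" where
  "is_circuit E Ind C \<longleftrightarrow> C \<subseteq> E \<and> C \<notin> Ind \<and> (\<forall>D. D \<subset> C \<longrightarrow> D \<in> Ind)"

definition matroid_rank :: "'a set set \<Rightarrow> nat" where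
  "matroid_rank Ind = Max (card ` Ind)"

text \<open>The independent sets of the dual are the subsets of complements of bases.\<close>

definition dual :: "'a set \<Rightarrow> 'a set set \<Rightarrow> 'a set set" where
  "dual E Ind = {X. \<exists>B. is_basis Ind B \<and> X \<subseteq> E - B}"

definition is_loop :: "'a set \<Rightarrow> 'a set set \<Rightarrow> 'a \<Rightarrow> bool" where
  "is_loop E Ind e \<longleftrightarrow> is_circuit E Ind {e}"

definition is_coloop :: "'a set \<Rightarrow> 'a set set \<Rightarrow> 'a \<Rightarrow> bool" where
  "is_coloop E Ind e \<longleftrightarrow> is_loop E (dual E Ind) e"

definition paving :: "'a set \<Rightarrow> 'a set set \<Rightarrow> bool" where
  "paving E Ind \<longleftrightarrow> (\<forall>C. is_circuit E Ind C \<longrightarrow> matroid_rank Ind \<le> card C)"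

definition sparse_paving :: "'a set \<Rightarrow> 'a set set \<Rightarrow> bool" where
  "sparse_paving E Ind \<longleftrightarrow> paving E Ind \<and> paving E (dual E Ind)"

definition num_loopless_coloopless :: "nat \<Rightarrow> nat" where
  "num_loopless_coloopless n =
     card {Ind. matroid {1..n} Ind \<and>
                (\<nexists>e. is_loop {1..n} Ind e) \<and> (\<nexists>e. is_coloop {1..n} Ind e)}"

definition num_sparse_paving :: "nat \<Rightarrow> nat" where
  "num_sparse_paving n = card {Ind. matroid {1..n} Ind \<and> sparse_paving {1..n} Ind}"

end

theory Submission
  imports Defs "HOL-Real_Asymp.Real_Asymp"
begin

text \<open>
  Call two \<open>r\<close>-sets adjacent if they differ by one exchange (the Johnson graph). Stable sets of this
  graph are exactly the sets of non-bases of sparse paving matroids of rank \<open>r\<close>. The residue classes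
  of element sums modulo \<open>n\<close> are stable, so \<open>log s\<^sub>n \<ge> N / n\<close> with \<open>N\<close> the central binomial coefficient.

  Conversely, a matroid of rank \<open>r\<close> is determined by a stable set and \<open>o(N / n)\<close> further bits. With
  \<open>k \<approx> n\<^sup>3\<^sup>/\<^sup>4\<close>, record the dependent sets with fewer than \<open>k\<close> elements, the hyperplanes containing at
  least \<open>k\<^sup>2 / 4\<close> independent \<open>(r - 1)\<close>-sets, and the same two families of the dual. Every independent
  \<open>(r - 1)\<close>-set lies in only one hyperplane, so there are at most \<open>4 N / k\<^sup>2\<close> recorded hyperplanes, and
  describing each of them costs \<open>O(log n)\<close> bits. Let \<open>V\<close> be a maximal stable set among the non-bases that are
  not explained by these families. If a non-basis \<open>X\<close> is unexplained and adjacent to \<open>Y \<in> V\<close>, then \<open>X \<union> Y\<close> has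
  rank \<open>r - 1\<close> or, dually, \<open>X \<inter> Y\<close> has nullity 1. In the first case \<open>X \<union> Y\<close> has nullity 2, and
  were all its circuits of size at least \<open>k\<close>, it would contain \<open>k\<^sup>2 / 4\<close> independent \<open>(r - 1)\<close>-sets and
  hence span a recorded hyperplane. So \<open>X \<union> Y\<close> contains a recorded dependent set, which conversely,
  not being contained in \<open>Y\<close>, forces \<open>X\<close> to be dependent.
\<close>

section \<open>Spans and small dependent sets\<close>

context matroid
begin

section \<open>Bases, extension of independent sets, and duality\<close>

lemma indep_finite: "I \<in> Ind \<Longrightarrow> finite I"
  using finite_ground indep_subset_ground finite_subset by blast

lemma finite_Ind: "finite Ind"
  using finite_ground indep_subset_ground by (meson Pow_iff finite_Pow_iff finite_subset subsetI)

lemma card_le_rank: "I \<in> Ind \<Longrightarrow> card I \<le> matroid_rank Ind"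
  unfolding matroid_rank_def using finite_Ind by simp

lemma obtain_basis:
  obtains B where "B \<in> Ind" "card B = matroid_rank Ind"
proof -
  have "Max (card ` Ind) \<in> card ` Ind"
    using finite_Ind indep_empty by (intro Max_in) auto
  then show thesis using that unfolding matroid_rank_def by auto
qed

text \<open>Augmentation from \<open>J\<close>, one element at a time;
  \<open>K \<subseteq> I \<union> J\<close> later controls which elements \<open>K\<close> can
  contain.\<close>

lemma indep_extend:
  assumes "I \<in> Ind" "J \<in> Ind" "card I \<le> m" "m \<le> card J"
  obtains K where "K \<in> Ind" "I \<subseteq> K" "K \<subseteq> I \<union> J" "card K = m"
proof -
  have "\<exists>K\<in>Ind. I \<subseteq> K \<and> K \<subseteq> I \<union> J \<and> card K = m"
    using assms(3,4)
  proof (induction m rule: dec_induct)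
    case base
    then show ?case using assms(1) by blast
  next
    case (step m)
    then obtain K where K: "K \<in> Ind" "I \<subseteq> K" "K \<subseteq> I \<union> J" "card K = m" by auto
    then obtain y where y: "y \<in> J - K" "insert y K \<in> Ind"
      using augment[of K J] assms(2) step by auto
    then show ?case using K indep_finite[of K] by (intro bexI[of _ "insert y K"]) auto
  qed
  then show thesis using that by blast
qed

lemma is_basis_iff: "is_basis Ind B \<longleftrightarrow> B \<in> Ind \<and> card B = matroid_rank Ind"
proof
  assume B: "is_basis Ind B"
  obtain B' where B': "B' \<in> Ind" "card B' = matroid_rank Ind" by (rule obtain_basis)
  have "\<not> card B < card B'"
    using augment[of B B'] B B'(1) unfolding is_basis_def by blast
  then show "B \<in> Ind \<and> card B = matroid_rank Ind"
    using B B' card_le_rank[of B] unfolding is_basis_def by simp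
next
  assume B: "B \<in> Ind \<and> card B = matroid_rank Ind"
  have "X = B" if "X \<in> Ind" "B \<subseteq> X" for X
    using card_seteq[OF indep_finite[OF that(1)] that(2)] card_le_rank[OF that(1)] B by simp
  then show "is_basis Ind B" using B unfolding is_basis_def by blast
qed

lemma mem_dual_iff:
  "X \<in> dual E Ind \<longleftrightarrow> X \<subseteq> E \<and> (\<exists>B\<in>Ind. card B = matroid_rank Ind \<and> X \<inter> B = {})"
  unfolding dual_def is_basis_iff by blast

lemma matroid_dual: "matroid E (dual E Ind)"
proof
  show "finite E" by (rule finite_ground)
  show "X \<subseteq> E" if "X \<in> dual E Ind" for X using that by (simp add: mem_dual_iff)
  show "{} \<in> dual E Ind" using obtain_basis by (auto simp: mem_dual_iff)
  show "Y \<in> dual E Ind" if "X \<in> dual E Ind" "Y \<subseteq> X" for X Y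
    using that unfolding mem_dual_iff by blast
next
  fix X Y assume X: "X \<in> dual E Ind" and Y: "Y \<in> dual E Ind" and less: "card X < card Y"
  obtain B where B: "B \<in> Ind" "card B = matroid_rank Ind" "X \<inter> B = {}"
    using X by (auto simp: mem_dual_iff)
  obtain B' where B': "B' \<in> Ind" "card B' = matroid_rank Ind" "Y \<inter> B' = {}"
    using Y by (auto simp: mem_dual_iff)
  have fin: "finite X" "finite Y" "finite B'"
    using X Y B' finite_ground finite_subset by (auto simp: mem_dual_iff indep_finite)
  \<comment> \<open>The basis \<open>K\<close> extends \<open>B' - X\<close> by elements of
    \<open>B\<close>, so it misses \<open>X\<close>. Containing \<open>Y - X\<close> as well would
    make it larger than \<open>B'\<close>, since
    \<open>card (B' \<inter> X) \<le> card (X - Y) < card (Y - X)\<close>.\<close>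
  have "B' - X \<in> Ind" using B' indep_subset by blast
  moreover from this have "card (B' - X) \<le> matroid_rank Ind" by (rule card_le_rank)
  ultimately obtain K where K: "K \<in> Ind" "B' - X \<subseteq> K" "K \<subseteq> (B' - X) \<union> B" "card K = matroid_rank Ind"
    using indep_extend[OF _ B(1), of "B' - X" "matroid_rank Ind"] B(2) by (metis order_refl)
  have "\<not> Y - X \<subseteq> K"
  proof
    assume "Y - X \<subseteq> K"
    then have "card ((B' - X) \<union> (Y - X)) \<le> card K"
      using K indep_finite by (intro card_mono) auto
    moreover have "card ((B' - X) \<union> (Y - X)) = card (B' - X) + card (Y - X)"
      using fin B'(3) by (intro card_Un_disjoint) auto
    moreover have "card B' = card (B' - X) + card (B' \<inter> X)"
      using card_Int_Diff[OF fin(3), of X] by simp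
    moreover have "card (B' \<inter> X) \<le> card (X - Y)"
      using fin B'(3) by (intro card_mono) auto
    ultimately have "card (Y - X) \<le> card (X - Y)" using K(4) B'(2) by linarith
    then show False
      using less fin card_Int_Diff[of X Y] card_Int_Diff[of Y X] by (simp add: Int_commute)
  qed
  then obtain y where "y \<in> Y - X" "y \<notin> K" by blast
  then show "\<exists>y\<in>Y - X. insert y X \<in> dual E Ind"
    using X Y K B(3) by (intro bexI[of _ y]) (auto simp: mem_dual_iff intro!: bexI[of _ K])
qed

lemma rank_le_card: "matroid_rank Ind \<le> card E"
  using obtain_basis card_mono[OF finite_ground] indep_subset_ground by metis

lemma rank_dual: "matroid_rank (dual E Ind) = card E - matroid_rank Ind"
proof (rule antisym)
  obtain X where X: "X \<in> dual E Ind" "card X = matroid_rank (dual E Ind)"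
    by (rule matroid.obtain_basis[OF matroid_dual])
  then obtain B where B: "B \<in> Ind" "card B = matroid_rank Ind" "X \<inter> B = {}" "X \<subseteq> E"
    by (auto simp: mem_dual_iff)
  have "card X \<le> card (E - B)" using B finite_ground by (intro card_mono) auto
  then show "matroid_rank (dual E Ind) \<le> card E - matroid_rank Ind"
    using B X card_Diff_subset[OF indep_finite indep_subset_ground, of B] by simp
  obtain C where C: "C \<in> Ind" "card C = matroid_rank Ind" by (rule obtain_basis)
  then have "E - C \<in> dual E Ind" by (auto simp: mem_dual_iff)
  then show "card E - matroid_rank Ind \<le> matroid_rank (dual E Ind)"
    using matroid.card_le_rank[OF matroid_dual, of "E - C"] C
      card_Diff_subset[OF indep_finite indep_subset_ground, of C] by simp
qed

lemma compl_mem_dual_iff: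
  assumes "X \<subseteq> E" "card X = matroid_rank Ind"
  shows "E - X \<in> dual E Ind \<longleftrightarrow> X \<in> Ind"
proof
  assume "E - X \<in> dual E Ind"
  then obtain B where B: "B \<in> Ind" "card B = matroid_rank Ind" "(E - X) \<inter> B = {}"
    by (auto simp: mem_dual_iff)
  then have "B \<subseteq> X" using indep_subset_ground by blast
  then have "B = X" using assms B finite_ground by (intro card_subset_eq) (auto intro: finite_subset)
  then show "X \<in> Ind" using B by simp
qed (use assms in \<open>auto simp: mem_dual_iff\<close>)

text \<open>For independent \<open>I\<close> this is the closure of \<open>I\<close>; for dependent \<open>I\<close> it is all of \<open>E\<close>.\<close>

definition spn :: "'a set \<Rightarrow> 'a set" where
  "spn I = {e \<in> E. e \<in> I \<or> insert e I \<notin> Ind}"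

lemma subset_spn: "I \<in> Ind \<Longrightarrow> I \<subseteq> spn I"
  unfolding spn_def using indep_subset_ground by blast

lemma spn_mono: "I \<subseteq> J \<Longrightarrow> J \<in> Ind \<Longrightarrow> spn I \<subseteq> spn J"
  unfolding spn_def using indep_subset[of "insert _ J" "insert _ I"] by auto

lemma card_le_of_subset_spn:
  assumes "I \<in> Ind" "J \<in> Ind" "J \<subseteq> spn I"
  shows "card J \<le> card I"
  using augment[of I J] assms unfolding spn_def by force

text \<open>If some \<open>e\<close> in \<open>spn J\<close> extended \<open>I\<close>, augmenting
  \<open>J\<close> from \<open>insert e I\<close> would have to use an element of \<open>I\<close>,
  giving too large an independent set in \<open>spn I\<close>. Hence an independent
  \<open>(r - 1)\<close>-set fixes its hyperplane.\<close>

lemma spn_eq: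
  assumes I: "I \<in> Ind" and J: "J \<in> Ind" "J \<subseteq> spn I" "card J = card I"
  shows "spn J = spn I"
proof (rule ccontr)
  have fin: "finite I" "finite J" using I J indep_finite by auto
  have no_ext: "e \<in> J" if "e \<in> spn I" "insert e J \<in> Ind" for e
    using card_le_of_subset_spn[OF I that(2)] that(1) J fin by (cases "e \<in> J") auto
  assume "spn J \<noteq> spn I"
  moreover have "spn I \<subseteq> spn J" using no_ext unfolding spn_def by blast
  ultimately obtain e where e: "e \<in> spn J" "e \<notin> spn I" by blast
  then have eI: "insert e I \<in> Ind" "e \<notin> I" unfolding spn_def by auto
  then obtain y where y: "y \<in> insert e I - J" "insert y J \<in> Ind"
    using augment[of J "insert e I"] J fin by auto
  have "y \<noteq> e" using e(1) y unfolding spn_def by auto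
  then have "y \<in> spn I" using y subset_spn[OF I] by blast
  then show False using no_ext y by blast
qed

text \<open>The set on the left is the fundamental circuit of \<open>e\<close> with respect to \<open>I\<close>.\<close>

lemma fundamental_circuit_dependent:
  assumes I: "I \<in> Ind" and e: "insert e I \<notin> Ind"
  shows "{c \<in> insert e I. insert e I - {c} \<in> Ind} \<notin> Ind"
proof
  let ?C = "{c \<in> insert e I. insert e I - {c} \<in> Ind}"
  assume C: "?C \<in> Ind"
  have fin: "finite I" and eI: "e \<notin> I" using I e indep_finite by (auto simp: insert_absorb)
  have "?C \<noteq> insert e I" using C e by metis
  then have "?C \<subset> insert e I" by blast
  then have "card ?C \<le> card I" using psubset_card_mono[of "insert e I" ?C] fin eI by simp
  then obtain K where K: "K \<in> Ind" "?C \<subseteq> K" "K \<subseteq> ?C \<union> I" "card K = card I"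
    using indep_extend[OF C I, of "card I"] by blast
  have "card (insert e I - K) = 1"
    using K fin eI card_Diff_subset[of K "insert e I"] indep_finite[of K] by auto
  then obtain c where c: "insert e I - K = {c}" by (auto simp: card_1_singleton_iff)
  then have "insert e I - {c} \<in> Ind" using indep_subset[OF K(1), of "insert e I - {c}"] by blast
  then show False using c K(2) by blast
qed

definition indeps_in :: "nat \<Rightarrow> 'a set \<Rightarrow> 'a set set" where
  "indeps_in m W = {I \<in> Ind. I \<subseteq> W \<and> card I = m}"

text \<open>The two elements omitted from \<open>J \<union> {a, b}\<close> are chosen one after the other, each from a
  fundamental circuit; every resulting set arises from at most four pairs.\<close>

lemma many_bases:
  assumes J: "J \<in> Ind" and ab: "a \<noteq> b" "{a, b} \<subseteq> spn J - J"
    and small: "\<And>A. A \<subseteq> insert a (insert b J) \<Longrightarrow> card A < k \<Longrightarrow> A \<in> Ind"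
  shows "k\<^sup>2 \<le> 4 * card (indeps_in (card J) (insert a (insert b J)))"
proof -
  define W where "W = insert a (insert b J)"
  define P where "P c = {c' \<in> W - {c}. W - {c} - {c'} \<in> Ind}" for c
  have fin: "finite W" and cW: "card W = card J + 2"
    unfolding W_def using J ab indep_finite by auto
  have dep: "k \<le> card A" if "A \<subseteq> W" "A \<notin> Ind" for A
    using small[of A] that unfolding W_def by force
  have W_spn: "W \<subseteq> spn J" unfolding W_def using ab subset_spn[OF J] by auto
  define C where "C = {c \<in> insert b J. insert b J - {c} \<in> Ind}"
  have "insert b J \<notin> Ind" using ab unfolding spn_def by auto
  then have "C \<notin> Ind" unfolding C_def using fundamental_circuit_dependent[OF J] by blast
  moreover have CW: "C \<subseteq> W" unfolding C_def W_def by auto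
  ultimately have kC: "k \<le> card C" using dep by blast
  have kP: "k \<le> card (P c)" if "c \<in> C" for c
  proof -
    let ?I = "insert b J - {c}"
    have c: "c \<in> insert b J" "?I \<in> Ind" using that unfolding C_def by auto
    then have ca: "c \<noteq> a" using ab by auto
    have eq: "insert a ?I = W - {c}" unfolding W_def using ca by auto
    \<comment> \<open>\<open>W - {c}\<close> lies in \<open>spn J\<close> but is larger than
      \<open>J\<close>, hence dependent; \<open>P c\<close> is the fundamental circuit of
      \<open>a\<close> with respect to \<open>?I\<close>.\<close>
    have "card (W - {c}) = card J + 1" using cW CW that fin by (simp add: card_Diff_singleton subset_iff)
    then have "W - {c} \<notin> Ind" using card_le_of_subset_spn[OF J, of "W - {c}"] W_spn by auto
    then have "P c \<notin> Ind" using fundamental_circuit_dependent[OF c(2), of a]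
      unfolding P_def eq by simp
    moreover have "P c \<subseteq> W" unfolding P_def by auto
    ultimately show ?thesis using dep by blast
  qed
  have finP: "finite (P c)" for c unfolding P_def using fin by auto
  have "k\<^sup>2 \<le> card C * k" using kC by (simp add: power2_eq_square)
  also have "\<dots> = (\<Sum>c\<in>C. k)" by simp
  also have "\<dots> \<le> (\<Sum>c\<in>C. card (P c))" using kP by (intro sum_mono) auto
  also have "\<dots> = card (Sigma C P)"
    using CW fin finP by (simp add: card_SigmaI finite_subset)
  also have "\<dots> \<le> card (\<Union>I\<in>indeps_in (card J) W. (W - I) \<times> (W - I))"
  proof (rule card_mono)
    show "finite (\<Union>I\<in>indeps_in (card J) W. (W - I) \<times> (W - I))"
      using fin finite_Ind unfolding indeps_in_def by auto
    show "Sigma C P \<subseteq> (\<Union>I\<in>indeps_in (card J) W. (W - I) \<times> (W - I))"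
    proof (clarify)
      fix c c' assume c: "c \<in> C" "c' \<in> P c"
      let ?I = "W - {c} - {c'}"
      have "card ?I = card J"
        using c CW fin cW unfolding P_def by (auto simp: card_Diff_singleton subset_iff)
      then have "?I \<in> indeps_in (card J) W" using c unfolding indeps_in_def P_def by auto
      moreover have "(c, c') \<in> (W - ?I) \<times> (W - ?I)" using c CW unfolding P_def by auto
      ultimately show "(c, c') \<in> (\<Union>I\<in>indeps_in (card J) W. (W - I) \<times> (W - I))" by blast
    qed
  qed
  also have "\<dots> \<le> (\<Sum>I\<in>indeps_in (card J) W. card ((W - I) \<times> (W - I)))"
    using finite_Ind unfolding indeps_in_def by (intro card_UN_le) auto
  also have "\<dots> = (\<Sum>I\<in>indeps_in (card J) W. 4)"
    using fin cW by (intro sum.cong) (auto simp: indeps_in_def card_Diff_subset finite_subset card_cartesian_product)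
  finally show ?thesis unfolding W_def by simp
qed

section \<open>Small dependent sets and rich hyperplanes\<close>

definition small_deps :: "nat \<Rightarrow> 'a set set" where
  "small_deps k = {A. A \<subseteq> E \<and> card A < k \<and> A \<notin> Ind}"

definition rich_hyps :: "nat \<Rightarrow> 'a set set" where
  "rich_hyps k = {spn I |I. I \<in> Ind \<and> card I + 1 = matroid_rank Ind \<and>
     k\<^sup>2 \<le> 4 * card (indeps_in (card I) (spn I))}"

definition nonbases :: "'a set set" where
  "nonbases = {X. X \<subseteq> E \<and> card X = matroid_rank Ind \<and> X \<notin> Ind}"

lemma subset_rich_hyp_dependent:
  assumes "H \<in> rich_hyps k" "X \<subseteq> H" "card X = matroid_rank Ind"
  shows "X \<notin> Ind"
  using assms card_le_of_subset_spn[of _ X] unfolding rich_hyps_def by fastforce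

text \<open>An independent \<open>(r - 1)\<close>-set contained in two hyperplanes spans both, so
  they coincide by \<open>spn_eq\<close>. Rich hyperplanes thus use up disjoint families of
  \<open>(r - 1)\<close>-subsets of \<open>E\<close>.\<close>

lemma card_rich_hyps: "card (rich_hyps k) * k\<^sup>2 \<le> 4 * (card E choose (matroid_rank Ind - 1))"
proof -
  let ?r = "matroid_rank Ind - 1"
  have fin: "finite (rich_hyps k)"
    unfolding rich_hyps_def using finite_Ind by simp
  have fin': "finite (indeps_in m H)" for m H using finite_Ind unfolding indeps_in_def by simp
  have "card (rich_hyps k) * k\<^sup>2 = (\<Sum>H\<in>rich_hyps k. k\<^sup>2)" by simp
  also have "\<dots> \<le> (\<Sum>H\<in>rich_hyps k. 4 * card (indeps_in ?r H))"
  proof (rule sum_mono)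
    fix H assume "H \<in> rich_hyps k"
    then obtain I where "H = spn I" "card I + 1 = matroid_rank Ind"
      "k\<^sup>2 \<le> 4 * card (indeps_in (card I) (spn I))" unfolding rich_hyps_def by auto
    then show "k\<^sup>2 \<le> 4 * card (indeps_in ?r H)" by (metis add_diff_cancel_right')
  qed
  also have "\<dots> = 4 * card (\<Union>H\<in>rich_hyps k. indeps_in ?r H)"
  proof -
    have "indeps_in ?r H \<inter> indeps_in ?r H' = {}"
      if H: "H \<in> rich_hyps k" "H' \<in> rich_hyps k" "H \<noteq> H'" for H H'
    proof (rule ccontr)
      assume "indeps_in ?r H \<inter> indeps_in ?r H' \<noteq> {}"
      then obtain J where J: "J \<in> Ind" "J \<subseteq> H" "J \<subseteq> H'" "card J = ?r"
        unfolding indeps_in_def by auto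
      obtain I where I: "H = spn I" "I \<in> Ind" "card I + 1 = matroid_rank Ind"
        using H(1) unfolding rich_hyps_def by blast
      obtain I' where I': "H' = spn I'" "I' \<in> Ind" "card I' + 1 = matroid_rank Ind"
        using H(2) unfolding rich_hyps_def by blast
      have "card I = ?r" "card I' = ?r" using I I' by linarith+
      with I I' have "spn J = H" "spn J = H'" using J spn_eq[of I J] spn_eq[of I' J] by auto
      then show False using H by simp
    qed
    then show ?thesis using fin fin' by (simp add: card_UN_disjoint sum_distrib_left)
  qed
  also have "card (\<Union>H\<in>rich_hyps k. indeps_in ?r H) \<le> card {X. X \<subseteq> E \<and> card X = ?r}"
    using finite_ground indep_subset_ground by (intro card_mono) (auto simp: indeps_in_def)
  also have "\<dots> = card E choose ?r" using n_subsets[OF finite_ground] by simp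
  finally show ?thesis by simp
qed

text \<open>Without a small dependent set, the sets produced by \<open>many_bases\<close> all lie in
  \<open>spn J\<close> and make it rich.\<close>

lemma rich_or_small_dep:
  assumes J: "J \<in> Ind" "card J + 1 = matroid_rank Ind" and ab: "a \<noteq> b" "{a, b} \<subseteq> spn J - J"
    and not_rich: "spn J \<notin> rich_hyps k"
  shows "\<exists>A\<in>small_deps k. A \<subseteq> insert a (insert b J)"
proof (rule ccontr)
  assume no: "\<not> (\<exists>A\<in>small_deps k. A \<subseteq> insert a (insert b J))"
  have sub: "insert a (insert b J) \<subseteq> spn J" using ab subset_spn[OF J(1)] by auto
  have "A \<in> Ind" if "A \<subseteq> insert a (insert b J)" "card A < k" for A
    using no that sub unfolding small_deps_def spn_def by auto
  then have "k\<^sup>2 \<le> 4 * card (indeps_in (card J) (insert a (insert b J)))"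
    using many_bases[OF J(1) ab] by blast
  also have "card (indeps_in (card J) (insert a (insert b J))) \<le> card (indeps_in (card J) (spn J))"
    using sub finite_Ind by (intro card_mono) (auto simp: indeps_in_def)
  finally show False using not_rich J unfolding rich_hyps_def by auto
qed

text \<open>If \<open>X\<close> had rank below \<open>r - 1\<close>, a maximal independent
  \<open>J\<close> in \<open>X\<close> would miss two elements \<open>a\<close>, \<open>b\<close>.
  Enlarge \<open>J\<close> to an independent \<open>(r - 1)\<close>-set \<open>J'\<close>, whose
  span contains \<open>X\<close>; then \<open>J'\<close>, \<open>a\<close>, \<open>b\<close>
  contradict \<open>rich_or_small_dep\<close>.\<close>

lemma uncovered_nonbasis_rank:
  assumes X: "X \<in> nonbases"
    and no_small: "\<And>A. A \<in> small_deps k \<Longrightarrow> \<not> A \<subseteq> X"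
    and no_rich: "\<And>H. H \<in> rich_hyps k \<Longrightarrow> \<not> X \<subseteq> H"
  obtains J where "J \<in> Ind" "J \<subseteq> X" "card J + 1 = matroid_rank Ind" "X \<subseteq> spn J"
proof -
  let ?S = "{I \<in> Ind. I \<subseteq> X}"
  have X': "X \<subseteq> E" "card X = matroid_rank Ind" "X \<notin> Ind" "finite X"
    using X finite_ground finite_subset unfolding nonbases_def by auto
  have "\<exists>J\<in>?S. \<forall>I\<in>?S. J \<subseteq> I \<longrightarrow> J = I"
    using finite_Ind indep_empty by (intro finite_has_maximal) auto
  then obtain J where J: "J \<in> Ind" "J \<subseteq> X" and max: "\<And>I. I \<in> Ind \<Longrightarrow> I \<subseteq> X \<Longrightarrow> J \<subseteq> I \<Longrightarrow> J = I"
    by auto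
  have XJ: "X \<subseteq> spn J"
  proof
    fix e assume "e \<in> X"
    then show "e \<in> spn J" using max[of "insert e J"] J X' unfolding spn_def by auto
  qed
  have "card J < card X" using J X' by (metis psubsetI psubset_card_mono)
  moreover have "\<not> card J + 1 < card X"
  proof
    assume less: "card J + 1 < card X"
    have "card (X - J) = card X - card J" using J X' by (meson card_Diff_subset finite_subset)
    then have "card (X - J) \<ge> 2" using less by linarith
    then obtain a b where ab: "a \<noteq> b" "a \<in> X - J" "b \<in> X - J"
      by (metis card_le_Suc0_iff_eq X'(4) finite_Diff not_less_eq_eq numeral_2_eq_2)
    obtain B where "B \<in> Ind" "card B = matroid_rank Ind" by (rule obtain_basis)
    moreover have "card J \<le> matroid_rank Ind - 1" using less X' by linarith
    ultimately obtain J' where J': "J' \<in> Ind" "J \<subseteq> J'" "card J' = matroid_rank Ind - 1"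
      using indep_extend[OF J(1), of B "matroid_rank Ind - 1"] by (metis diff_le_self)
    have finJ': "finite J'" using J' indep_finite by blast
    have spnJ': "spn J \<subseteq> spn J'" using spn_mono J' by blast
    have outside: "e \<notin> spn J" if "e \<in> J' - J" for e
      using that J' indep_subset[of J' "insert e J"] unfolding spn_def by auto
    \<comment> \<open>Elements of \<open>A\<close> outside \<open>A0\<close> lie in
      \<open>J' - J\<close>. Extending \<open>A0\<close> by \<open>J'\<close> to size
      \<open>card J'\<close> gives \<open>K\<close> with at most \<open>card J\<close> elements in
      \<open>spn J\<close>; so \<open>K\<close> takes all of \<open>J' - J\<close> and contains
      \<open>A\<close>.\<close>
    have "A \<in> Ind" if A: "A \<subseteq> insert a (insert b J')" "card A < k" for A
    proof -
      define A0 where "A0 = A \<inter> insert a (insert b J)"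
      have finA: "finite A" using A finJ' by (meson finite.insertI finite_subset)
      have "A0 \<subseteq> X" "card A0 < k"
        using ab J A card_mono[OF finA, of A0] unfolding A0_def by auto
      then have A0: "A0 \<in> Ind" using no_small[of A0] X' unfolding small_deps_def by auto
      have "A0 \<subseteq> spn J" using \<open>A0 \<subseteq> X\<close> XJ by blast
      then have "card A0 \<le> card J'"
        using card_le_of_subset_spn[OF J'(1) A0] spnJ' by blast
      then obtain K where K: "K \<in> Ind" "A0 \<subseteq> K" "K \<subseteq> A0 \<union> J'" "card K = card J'"
        using indep_extend[OF A0 J'(1)] by blast
      have finK: "finite K" using K indep_finite by blast
      have "card (K \<inter> spn J) \<le> card J"
        using card_le_of_subset_spn[OF J(1), of "K \<inter> spn J"] indep_subset[OF K(1)] by auto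
      moreover have "card K = card (K \<inter> spn J) + card (K - spn J)"
        using card_Int_Diff[OF finK] by simp
      moreover have "card (J' - J) = card J' - card J"
        using J' finJ' card_Diff_subset finite_subset by metis
      ultimately have "card (J' - J) \<le> card (K - spn J)" using K(4) by linarith
      moreover have "K - spn J \<subseteq> J' - J" using K(3) \<open>A0 \<subseteq> spn J\<close> subset_spn[OF J(1)] by auto
      ultimately have "K - spn J = J' - J" using finJ' by (intro card_seteq) auto
      then have "A \<subseteq> K" using A K(2) unfolding A0_def by blast
      then show ?thesis using K indep_subset by blast
    qed
    moreover have "{a, b} \<subseteq> spn J' - J'"
      using ab XJ spnJ' outside by blast
    moreover have "card J' + 1 = matroid_rank Ind" using J' less X' by simp
    moreover have "spn J' \<notin> rich_hyps k" using no_rich XJ spnJ' by blast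
    ultimately show False
      using rich_or_small_dep[OF J'(1), of a b k] ab unfolding small_deps_def by blast
  qed
  ultimately have "card J + 1 = card X" by linarith
  then show thesis using that J XJ X' by simp
qed

text \<open>\<open>A\<close> contains the only element \<open>x\<close> of \<open>X - Y\<close>. If
  \<open>X\<close> were a basis, extending \<open>A \<inter> Y\<close> by \<open>X\<close> would
  give a basis \<open>K\<close> without \<open>x\<close>, as otherwise
  \<open>A \<subseteq> K\<close>; but then \<open>K = Y\<close>, a nonbasis.\<close>

lemma small_dep_in_union_dependent:
  assumes Y: "Y \<in> nonbases" "\<And>A. A \<in> small_deps k \<Longrightarrow> \<not> A \<subseteq> Y"
    and X: "card X = matroid_rank Ind" "card (X \<inter> Y) + 1 = matroid_rank Ind"
    and A: "A \<in> small_deps k" "A \<subseteq> X \<union> Y"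
  shows "X \<notin> Ind"
proof
  assume XI: "X \<in> Ind"
  have Y': "Y \<subseteq> E" "card Y = matroid_rank Ind" "Y \<notin> Ind" "finite Y"
    using Y finite_ground finite_subset unfolding nonbases_def by auto
  have finX: "finite X" using XI indep_finite by blast
  have "card (X - Y) = 1" using X card_Int_Diff[OF finX, of Y] by linarith
  then obtain x where x: "X - Y = {x}" by (auto simp: card_1_singleton_iff)
  have finA: "finite A" using A finX Y' by (meson finite_Un finite_subset)
  have AY: "A \<inter> Y \<in> Ind"
    using Y(2)[of "A \<inter> Y"] A card_mono[OF finA, of "A \<inter> Y"] unfolding small_deps_def by auto
  have "x \<in> A" "A \<notin> Ind" using Y(2)[OF A(1)] A x unfolding small_deps_def by auto
  obtain K where K: "K \<in> Ind" "A \<inter> Y \<subseteq> K" "K \<subseteq> (A \<inter> Y) \<union> X" "card K = card X"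
    using indep_extend[OF AY XI, of "card X"] card_le_rank[OF AY] X by auto
  have "x \<notin> K"
  proof
    assume xK: "x \<in> K"
    have "A \<subseteq> insert x (A \<inter> Y)" using A(2) x by auto
    then have "A \<subseteq> K" using K(2) xK by auto
    then show False using K \<open>A \<notin> Ind\<close> indep_subset by blast
  qed
  then have "K \<subseteq> Y" using K(3) x by auto
  then have "K = Y" using K X Y' by (intro card_subset_eq) auto
  then show False using K(1) Y'(3) by blast
qed

end

section \<open>Encoding a matroid by a stable set\<close>

text \<open>Among \<open>r\<close>-sets, meeting in \<open>r - 1\<close> elements is adjacency in
  the Johnson graph; for \<open>X = Y\<close> the condition holds automatically.\<close>

definition johnson_stable :: "nat \<Rightarrow> 'a set set \<Rightarrow> bool" where
  "johnson_stable r V \<longleftrightarrow> (\<forall>X\<in>V. \<forall>Y\<in>V. card (X \<inter> Y) + 1 \<noteq> r)"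

text \<open>\<open>D, Z\<close> stand for the small dependent sets and the rich hyperplanes, \<open>D', Z'\<close> for those of the
  dual, and \<open>V\<close> for the stable set.\<close>

definition decode ::
  "'a set \<Rightarrow> nat \<Rightarrow> 'a set set \<times> 'a set set \<times> 'a set set \<times> 'a set set \<times> 'a set set \<Rightarrow> 'a set set"
  where
  "decode E r = (\<lambda>(D, D', Z, Z', V). {X. X \<subseteq> E \<and> card X = r \<and>
     ((\<exists>A\<in>D. A \<subseteq> X) \<or> (\<exists>A\<in>D'. A \<subseteq> E - X) \<or> (\<exists>H\<in>Z. X \<subseteq> H) \<or> (\<exists>H\<in>Z'. E - X \<subseteq> H) \<or>
      X \<in> V \<or>
      (\<exists>Y\<in>V. card (X \<inter> Y) + 1 = r \<and>
        ((\<exists>A\<in>D. A \<subseteq> X \<union> Y) \<or> (\<exists>A\<in>D'. A \<subseteq> E - X \<inter> Y))))})"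

lemma adjacent_sets:
  assumes "finite X" "card X = r" "finite Y" "card Y = r" "card (X \<inter> Y) + 1 = r"
  obtains x y where "X - Y = {x}" "Y - X = {y}" "card (X \<union> Y) = r + 1"
proof -
  have "card (X - Y) = 1" "card (Y - X) = 1"
    using assms card_Int_Diff[of X Y] card_Int_Diff[of Y X] by (simp_all add: Int_commute)
  then obtain x y where xy: "X - Y = {x}" "Y - X = {y}" by (auto simp: card_1_singleton_iff)
  have "card (X \<union> Y) = r + 1"
    using card_Un_Int[of X Y] assms by linarith
  then show thesis using that xy by blast
qed

context matroid
begin

definition uncovered :: "nat \<Rightarrow> 'a set set" where
  "uncovered k = {X \<in> nonbases. (\<forall>A\<in>small_deps k. \<not> A \<subseteq> X) \<and> (\<forall>H\<in>rich_hyps k. \<not> X \<subseteq> H)}"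

lemma compl_nonbases:
  assumes "X \<in> nonbases"
  shows "E - X \<in> matroid.nonbases E (dual E Ind)"
proof -
  have X: "X \<subseteq> E" "card X = matroid_rank Ind" "X \<notin> Ind" "finite X"
    using assms finite_ground finite_subset unfolding nonbases_def by auto
  then show ?thesis
    using compl_mem_dual_iff[of X] unfolding matroid.nonbases_def[OF matroid_dual] rank_dual
    by (simp add: card_Diff_subset)
qed

text \<open>If \<open>y \<in> spn J\<close>, then \<open>X \<union> Y\<close> has rank
  \<open>r - 1\<close> and \<open>rich_or_small_dep\<close> applies to it. Otherwise the same lemma
  applies in the dual to \<open>E - X \<inter> Y\<close>.\<close>

lemma adjacent_uncovered:
  assumes X: "X \<in> uncovered k" "E - X \<in> matroid.uncovered E (dual E Ind) k"
    and Y: "Y \<in> nonbases" and adj: "card (X \<inter> Y) + 1 = matroid_rank Ind"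
  shows "(\<exists>A\<in>small_deps k. A \<subseteq> X \<union> Y) \<or>
    (\<exists>A\<in>matroid.small_deps E (dual E Ind) k. A \<subseteq> E - X \<inter> Y)"
proof -
  interpret co: matroid E "dual E Ind" by (rule matroid_dual)
  have X': "X \<in> nonbases" "X \<subseteq> E" "card X = matroid_rank Ind" "X \<notin> Ind" "finite X"
    using X finite_ground finite_subset unfolding uncovered_def nonbases_def by auto
  have Y': "Y \<subseteq> E" "card Y = matroid_rank Ind" "Y \<notin> Ind" "finite Y"
    using Y finite_ground finite_subset unfolding nonbases_def by auto
  obtain x y where diff: "X - Y = {x}" "Y - X = {y}"
    and union: "card (X \<union> Y) = matroid_rank Ind + 1"
    by (rule adjacent_sets[OF X'(5,3) Y'(4,2) adj])
  have xy: "x \<in> X" "x \<notin> Y" "y \<in> Y" "y \<notin> X" "x \<noteq> y" using diff by auto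
  have yE: "y \<in> E" "x \<in> E" using xy X' Y' by auto
  obtain J where J: "J \<in> Ind" "J \<subseteq> X" "card J + 1 = matroid_rank Ind" "X \<subseteq> spn J"
    by (rule uncovered_nonbasis_rank[OF X'(1), of k]) (use X(1) in \<open>auto simp: uncovered_def\<close>)
  have "card (X - J) = 1"
    using J X' card_Diff_subset[of J X] finite_subset[of J X] by simp
  then obtain a where a: "X - J = {a}" by (auto simp: card_1_singleton_iff)
  show ?thesis
  proof (cases "y \<in> spn J")
    case True
    have "spn J \<notin> rich_hyps k" using X J unfolding uncovered_def by auto
    moreover have "{a, y} \<subseteq> spn J - J" "a \<noteq> y" using True J(2,4) a xy by auto
    ultimately have "\<exists>A\<in>small_deps k. A \<subseteq> insert a (insert y J)"
      using rich_or_small_dep[OF J(1,3)] by blast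
    moreover have "insert a (insert y J) = X \<union> Y" using a J(2) diff by auto
    ultimately show ?thesis by simp
  next
    case False
    then have yJ: "insert y J \<in> Ind" "y \<notin> J" using yE unfolding spn_def by auto
    \<comment> \<open>\<open>J'\<close> misses the basis \<open>insert y J\<close>, so it is
      independent in the dual. The complements of \<open>X\<close> and \<open>Y\<close> add
      \<open>y\<close> and \<open>x\<close> to it and are dependent there, which puts both elements
      in its span.\<close>
    define J' where "J' = E - (X \<union> Y)"
    have "card (insert y J) = matroid_rank Ind" using yJ J indep_finite by simp
    moreover have "J' \<inter> insert y J = {}" unfolding J'_def using J(2) xy by auto
    ultimately have J'I: "J' \<in> dual E Ind" using yJ(1) unfolding mem_dual_iff J'_def by blast
    have le: "card (X \<union> Y) \<le> card E" using X' Y' finite_ground by (intro card_mono) auto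
    have "card J' = card E - (matroid_rank Ind + 1)"
      unfolding J'_def using union X' Y' card_Diff_subset[of "X \<union> Y" E] by simp
    then have cJ': "card J' + 1 = matroid_rank (dual E Ind)"
      using le union unfolding rank_dual by linarith
    have EX: "E - X = insert y J'" and EY: "E - Y = insert x J'"
      unfolding J'_def using diff yE xy by auto
    have "E - X \<notin> dual E Ind" "E - Y \<notin> dual E Ind"
      using compl_mem_dual_iff X' Y' by auto
    then have sp: "{x, y} \<subseteq> co.spn J' - J'"
      unfolding EX EY co.spn_def using yE xy by (simp add: J'_def)
    have "E - X \<subseteq> co.spn J'" using EX sp co.subset_spn[OF J'I] by auto
    then have "co.spn J' \<notin> co.rich_hyps k" using X(2) unfolding co.uncovered_def by auto
    then have "\<exists>A\<in>co.small_deps k. A \<subseteq> insert x (insert y J')"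
      using co.rich_or_small_dep[OF J'I cJ' xy(5) sp] by blast
    moreover have "insert x (insert y J') = E - X \<inter> Y"
      unfolding J'_def using diff yE xy by auto
    ultimately show ?thesis by simp
  qed
qed

lemma decode_sound:
  assumes V: "\<And>Y. Y \<in> V \<Longrightarrow> Y \<in> uncovered k \<and> E - Y \<in> matroid.uncovered E (dual E Ind) k"
    and X: "X \<in> decode E (matroid_rank Ind)
      (small_deps k, matroid.small_deps E (dual E Ind) k, rich_hyps k,
       matroid.rich_hyps E (dual E Ind) k, V)"
  shows "X \<in> nonbases"
proof -
  interpret co: matroid E "dual E Ind" by (rule matroid_dual)
  have X': "X \<subseteq> E" "card X = matroid_rank Ind" "finite X"
    using X finite_ground finite_subset unfolding decode_def by auto
  have cEX: "card (E - X) = matroid_rank (dual E Ind)"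
    using X' unfolding rank_dual by (simp add: card_Diff_subset)
  have XI: "X \<in> Ind \<longleftrightarrow> E - X \<in> dual E Ind" using compl_mem_dual_iff X' by simp
  consider A where "A \<in> small_deps k" "A \<subseteq> X" | A where "A \<in> co.small_deps k" "A \<subseteq> E - X"
    | H where "H \<in> rich_hyps k" "X \<subseteq> H" | H where "H \<in> co.rich_hyps k" "E - X \<subseteq> H"
    | "X \<in> V"
    | Y A where "Y \<in> V" "card (X \<inter> Y) + 1 = matroid_rank Ind" "A \<in> small_deps k" "A \<subseteq> X \<union> Y"
    | Y A where "Y \<in> V" "card (X \<inter> Y) + 1 = matroid_rank Ind" "A \<in> co.small_deps k"
      "A \<subseteq> E - X \<inter> Y"
    using X unfolding decode_def by auto
  then have "X \<notin> Ind"
  proof cases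
    case 1 then show ?thesis using indep_subset unfolding small_deps_def by blast
  next
    case 2 then show ?thesis using co.indep_subset XI unfolding co.small_deps_def by blast
  next
    case 3 then show ?thesis using subset_rich_hyp_dependent X' by blast
  next
    case 4 then show ?thesis using co.subset_rich_hyp_dependent cEX XI by blast
  next
    case 5 then show ?thesis using V unfolding uncovered_def nonbases_def by blast
  next
    case 6 then show ?thesis
      using V small_dep_in_union_dependent[of Y k X A] X' unfolding uncovered_def by blast
  next
    case 7
    \<comment> \<open>Complements of adjacent sets are adjacent: they meet in
      \<open>card E - (r + 1)\<close> elements, one less than the dual rank.\<close>
    have Y: "Y \<subseteq> E" "card Y = matroid_rank Ind" "finite Y"
      using V[OF 7(1)] finite_ground finite_subset unfolding uncovered_def nonbases_def by auto
    have "card (X \<union> Y) = matroid_rank Ind + 1"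
      using adjacent_sets[OF X'(3,2) Y(3,2) 7(2)] by blast
    moreover have "card (X \<union> Y) \<le> card E" using X' Y finite_ground by (intro card_mono) auto
    moreover have "card ((E - X) \<inter> (E - Y)) = card E - card (X \<union> Y)"
      using X' Y card_Diff_subset[of "X \<union> Y" E] by (simp add: Diff_Un)
    ultimately have adj: "card ((E - X) \<inter> (E - Y)) + 1 = matroid_rank (dual E Ind)"
      unfolding rank_dual by linarith
    have "A \<subseteq> (E - X) \<union> (E - Y)" using 7(4) by blast
    moreover have "E - Y \<in> co.nonbases" "\<And>A. A \<in> co.small_deps k \<Longrightarrow> \<not> A \<subseteq> E - Y"
      using V[OF 7(1)] unfolding co.uncovered_def by auto
    ultimately show ?thesis
      using co.small_dep_in_union_dependent[of "E - Y" k "E - X" A] cEX adj 7(3) XI by blast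
  qed
  then show ?thesis using X' unfolding nonbases_def by simp
qed

text \<open>Take \<open>V\<close> maximal stable in \<open>K\<close>. Any other member of
  \<open>K\<close> has a neighbour in \<open>V\<close> by maximality, so
  \<open>adjacent_uncovered\<close> explains it; nonbases outside \<open>K\<close> are explained by
  the recorded families alone.\<close>

lemma ex_stable_decode:
  "\<exists>V. V \<subseteq> nonbases \<and> johnson_stable (matroid_rank Ind) V \<and>
     nonbases = decode E (matroid_rank Ind)
      (small_deps k, matroid.small_deps E (dual E Ind) k, rich_hyps k,
       matroid.rich_hyps E (dual E Ind) k, V)"
proof -
  interpret co: matroid E "dual E Ind" by (rule matroid_dual)
  define K where "K = {X \<in> uncovered k. E - X \<in> co.uncovered k}"
  let ?S = "{V. V \<subseteq> K \<and> johnson_stable (matroid_rank Ind) V}"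
  have "K \<subseteq> Pow E" unfolding K_def uncovered_def nonbases_def by auto
  then have "finite K" using finite_ground finite_subset by blast
  then have "finite ?S" by simp
  moreover have "{} \<in> ?S" by (simp add: johnson_stable_def)
  ultimately have "\<exists>V\<in>?S. \<forall>W\<in>?S. V \<subseteq> W \<longrightarrow> V = W"
    using finite_has_maximal[of ?S] by blast
  then obtain V where V_max: "V \<in> ?S" "\<forall>W\<in>?S. V \<subseteq> W \<longrightarrow> V = W" by (rule bexE)
  have V: "V \<subseteq> K" "johnson_stable (matroid_rank Ind) V" using V_max(1) by auto
  have max: "V = W" if "W \<subseteq> K" "johnson_stable (matroid_rank Ind) W" "V \<subseteq> W" for W
    using V_max(2) that by auto
  have "X \<in> decode E (matroid_rank Ind)
      (small_deps k, co.small_deps k, rich_hyps k, co.rich_hyps k, V)" if X: "X \<in> nonbases" for X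
  proof -
    have X': "X \<subseteq> E" "card X = matroid_rank Ind" using X unfolding nonbases_def by auto
    show ?thesis
    proof (cases "X \<in> K \<and> X \<notin> V")
      case True
      then have "insert X V \<subseteq> K" "V \<noteq> insert X V" using V(1) by auto
      then have "\<not> johnson_stable (matroid_rank Ind) (insert X V)"
        using max[of "insert X V"] by (meson subset_insertI)
      then obtain Y where Y: "Y \<in> V" "card (X \<inter> Y) + 1 = matroid_rank Ind"
        using V(2) X' unfolding johnson_stable_def by (auto simp: Int_commute)
      moreover have "Y \<in> nonbases" using Y V unfolding K_def uncovered_def by auto
      ultimately have "(\<exists>A\<in>small_deps k. A \<subseteq> X \<union> Y) \<or> (\<exists>A\<in>co.small_deps k. A \<subseteq> E - X \<inter> Y)"
        using adjacent_uncovered[of X k Y] True unfolding K_def by blast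
      then show ?thesis using Y X' unfolding decode_def by blast
    next
      case False
      then have "X \<in> V \<or> (\<exists>A\<in>small_deps k. A \<subseteq> X) \<or> (\<exists>A\<in>co.small_deps k. A \<subseteq> E - X) \<or>
          (\<exists>H\<in>rich_hyps k. X \<subseteq> H) \<or> (\<exists>H\<in>co.rich_hyps k. E - X \<subseteq> H)"
        using X compl_nonbases[OF X] unfolding K_def uncovered_def co.uncovered_def by auto
      then show ?thesis using X' unfolding decode_def by auto
    qed
  qed
  moreover have "X \<in> nonbases" if "X \<in> decode E (matroid_rank Ind)
      (small_deps k, co.small_deps k, rich_hyps k, co.rich_hyps k, V)" for X
    by (rule decode_sound[OF _ that]) (use V in \<open>auto simp: K_def\<close>)
  moreover have "V \<subseteq> nonbases" using V unfolding K_def uncovered_def by auto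
  ultimately show ?thesis using V(2) by (intro exI[of _ V]) auto
qed

end

section \<open>Sparse paving matroids from stable sets\<close>

text \<open>Strict inclusion leaves some \<open>r\<close>-set outside \<open>V\<close> to serve as a
  basis.\<close>

definition stable_sets :: "'a set \<Rightarrow> nat \<Rightarrow> 'a set set set" where
  "stable_sets E r = {V. V \<subset> {X. X \<subseteq> E \<and> card X = r} \<and> johnson_stable r V}"

lemma finite_stable_sets: "finite E \<Longrightarrow> finite (stable_sets E r)"
  by (rule finite_subset[of _ "Pow (Pow E)"]) (auto simp: stable_sets_def)

definition sparse_paving_indeps :: "'a set \<Rightarrow> nat \<Rightarrow> 'a set set \<Rightarrow> 'a set set" where
  "sparse_paving_indeps E r V = {A. A \<subseteq> E \<and> card A \<le> r \<and> A \<notin> V}"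

lemma not_both_in_stable:
  assumes "johnson_stable r V" "card S + 1 = r" "finite S" "x \<noteq> y" "x \<notin> S" "y \<notin> S"
  shows "insert x S \<notin> V \<or> insert y S \<notin> V"
proof -
  have "insert x S \<inter> insert y S = S" using assms by auto
  then show ?thesis using assms(1,2) unfolding johnson_stable_def by metis
qed

text \<open>Augmentation by \<open>y\<close> fails only if \<open>insert y X\<close> is in
  \<open>V\<close>. Then \<open>Y\<close>, of the same size but not in \<open>V\<close>, offers
  another element \<open>z\<close>, and \<open>insert z X\<close> is adjacent to
  \<open>insert y X\<close>, hence outside \<open>V\<close>.\<close>

lemma matroid_sparse_paving_indeps:
  assumes E: "finite E" and V: "V \<in> stable_sets E r"
  shows "matroid E (sparse_paving_indeps E r V)"
proof
  have V': "V \<subseteq> {X. X \<subseteq> E \<and> card X = r}" "V \<noteq> {X. X \<subseteq> E \<and> card X = r}" "johnson_stable r V"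
    using V unfolding stable_sets_def by auto
  show "finite E" by (rule E)
  show "X \<subseteq> E" if "X \<in> sparse_paving_indeps E r V" for X
    using that unfolding sparse_paving_indeps_def by simp
  show "{} \<in> sparse_paving_indeps E r V"
  proof -
    have "{} \<notin> V"
    proof
      assume "{} \<in> V"
      then have "r = 0" using V' by auto
      then have "{X. X \<subseteq> E \<and> card X = r} = {{}}"
        using E by (auto simp: card_eq_0_iff dest: finite_subset)
      then show False using V' \<open>{} \<in> V\<close> by auto
    qed
    then show ?thesis unfolding sparse_paving_indeps_def by simp
  qed
  show "Y \<in> sparse_paving_indeps E r V" if X: "X \<in> sparse_paving_indeps E r V" and YX: "Y \<subseteq> X" for X Y
  proof -
    have X': "X \<subseteq> E" "card X \<le> r" "X \<notin> V" "finite X"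
      using X E finite_subset unfolding sparse_paving_indeps_def by auto
    have "Y \<notin> V"
    proof
      assume "Y \<in> V"
      then have "card Y = r" using V' by auto
      then have "Y = X" using card_seteq[OF X'(4) YX] X'(2) by simp
      then show False using X' \<open>Y \<in> V\<close> by simp
    qed
    moreover have "card Y \<le> r" using card_mono[OF X'(4) YX] X'(2) by simp
    ultimately show ?thesis using YX X' unfolding sparse_paving_indeps_def by auto
  qed
  show "\<exists>y\<in>Y - X. insert y X \<in> sparse_paving_indeps E r V"
    if X: "X \<in> sparse_paving_indeps E r V" and Y: "Y \<in> sparse_paving_indeps E r V"
      and less: "card X < card Y" for X Y
  proof -
    have X': "X \<subseteq> E" "card X \<le> r" "X \<notin> V" "finite X"
      using X E finite_subset unfolding sparse_paving_indeps_def by auto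
    have Y': "Y \<subseteq> E" "card Y \<le> r" "Y \<notin> V" "finite Y"
      using Y E finite_subset unfolding sparse_paving_indeps_def by auto
    have ins: "insert y X \<in> sparse_paving_indeps E r V" if "y \<in> Y - X" "insert y X \<notin> V" for y
      using that X' Y' less unfolding sparse_paving_indeps_def by auto
    have "\<not> Y \<subseteq> X" using card_mono[OF X'(4), of Y] less by auto
    then obtain y where y: "y \<in> Y - X" by auto
    show ?thesis
    proof (cases "insert y X \<in> V")
      case False
      then show ?thesis using ins y by blast
    next
      case True
      then have "card (insert y X) = r" using V' by auto
      then have cX: "card X + 1 = r" using y X' by simp
      have "Y \<noteq> insert y X" using True Y' by auto
      moreover have "card Y = card (insert y X)" using y X' Y' less cX by simp
      ultimately have "\<not> Y \<subseteq> insert y X" using X' card_subset_eq by (metis finite.insertI)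
      then obtain z where z: "z \<in> Y - X" "z \<noteq> y" by auto
      then have "insert z X \<notin> V"
        using not_both_in_stable[OF V'(3) cX X'(4), of y z] True y by auto
      then show ?thesis using ins z by blast
    qed
  qed
qed

lemma rank_sparse_paving_indeps:
  assumes E: "finite E" and V: "V \<in> stable_sets E r"
  shows "matroid_rank (sparse_paving_indeps E r V) = r"
proof -
  interpret matroid E "sparse_paving_indeps E r V" by (rule matroid_sparse_paving_indeps[OF E V])
  obtain B where "B \<subseteq> E" "card B = r" "B \<notin> V" using V unfolding stable_sets_def by blast
  then have "r \<le> matroid_rank (sparse_paving_indeps E r V)"
    using card_le_rank[of B] unfolding sparse_paving_indeps_def by simp
  moreover obtain C where "C \<in> sparse_paving_indeps E r V"
    "card C = matroid_rank (sparse_paving_indeps E r V)" by (rule obtain_basis)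
  ultimately show ?thesis unfolding sparse_paving_indeps_def by simp
qed

text \<open>Sets below size \<open>r\<close> are independent. Dually, a set of size below
  \<open>card E - r\<close> leaves at least \<open>r + 1\<close> elements; for \<open>r > 0\<close>
  these include two adjacent \<open>r\<close>-sets, which are not both in \<open>V\<close>, so a
  basis avoids the set.\<close>

lemma sparse_paving_sparse_paving_indeps:
  assumes E: "finite E" and V: "V \<in> stable_sets E r"
  shows "sparse_paving E (sparse_paving_indeps E r V)"
proof -
  let ?I = "sparse_paving_indeps E r V"
  interpret matroid E ?I by (rule matroid_sparse_paving_indeps[OF E V])
  have V': "V \<subseteq> {X. X \<subseteq> E \<and> card X = r}" "johnson_stable r V"
    using V unfolding stable_sets_def by auto
  have rank: "matroid_rank ?I = r" by (rule rank_sparse_paving_indeps[OF E V])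
  have "r \<le> card C" if "is_circuit E ?I C" for C
    using that V' unfolding is_circuit_def sparse_paving_indeps_def by auto
  then have "paving E ?I" unfolding paving_def rank by simp
  moreover have "card E - r \<le> card C" if C: "is_circuit E (dual E ?I) C" for C
  proof (rule ccontr)
    assume "\<not> card E - r \<le> card C"
    moreover have C': "C \<subseteq> E" "C \<notin> dual E ?I" using C unfolding is_circuit_def by auto
    moreover have "card (E - C) = card E - card C" "card C \<le> card E"
      using C' E card_Diff_subset[of C E] finite_subset card_mono by auto
    ultimately have "r + 1 \<le> card (E - C)" by linarith
    then obtain S where S: "S \<subseteq> E - C" "card S = r + 1" by (meson obtain_subset_with_card_n)
    have finS: "finite S" using S E finite_subset by (metis finite_Diff)
    have "\<exists>B. B \<subseteq> S \<and> card B = r \<and> B \<notin> V"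
    proof (cases "r = 0")
      case True
      have "{} \<notin> V" using indep_empty unfolding sparse_paving_indeps_def by simp
      then show ?thesis using True by (intro exI[of _ "{}"]) auto
    next
      case False
      then obtain S' where S': "S' \<subseteq> S" "card S' = r - 1" using S
        by (metis diff_le_self le_add1 obtain_subset_with_card_n order_trans)
      have "card (S - S') = 2" using S S' False finS card_Diff_subset[of S' S] finite_subset by fastforce
      then obtain x y where xy: "S - S' = {x, y}" "x \<noteq> y" by (auto simp: card_2_iff)
      have xyS: "x \<in> S" "y \<in> S" "x \<notin> S'" "y \<notin> S'" using xy by auto
      have finS': "finite S'" using S' finS finite_subset by blast
      have "card S' + 1 = r" using S' False by simp
      then have "insert x S' \<notin> V \<or> insert y S' \<notin> V" "card (insert x S') = r" "card (insert y S') = r"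
        using not_both_in_stable[OF V'(2) _ finS' xy(2)] xyS finS' by auto
      then show ?thesis using xyS S' by (metis insert_subset)
    qed
    then obtain B where B: "B \<subseteq> S" "card B = r" "B \<notin> V" by blast
    then have "B \<in> ?I" using S unfolding sparse_paving_indeps_def by auto
    then have "C \<in> dual E ?I" using B S C' unfolding mem_dual_iff rank by blast
    then show False using C' by simp
  qed
  then have "paving E (dual E ?I)" unfolding paving_def rank_dual rank by simp
  ultimately show ?thesis unfolding sparse_paving_def by simp
qed

text \<open>\<open>V\<close> is recovered as the family of \<open>r\<close>-sets that are not
  independent.\<close>

lemma card_stable_sets_le: "card (stable_sets {1..n} r) \<le> num_sparse_paving n"
  unfolding num_sparse_paving_def
proof (rule card_inj_on_le[of "sparse_paving_indeps {1..n} r"])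
  show "inj_on (sparse_paving_indeps {1..n} r) (stable_sets {1..n} r)"
  proof (rule inj_onI)
    fix V W assume VW: "V \<in> stable_sets {1..n} r" "W \<in> stable_sets {1..n} r"
      and eq: "sparse_paving_indeps {1..n} r V = sparse_paving_indeps {1..n} r W"
    have inverse: "U = {A. A \<subseteq> {1..n} \<and> card A = r \<and> A \<notin> sparse_paving_indeps {1..n} r U}"
      if "U \<in> stable_sets {1..n} r" for U
      using that unfolding stable_sets_def sparse_paving_indeps_def by auto
    show "V = W" by (subst inverse[OF VW(1)], subst inverse[OF VW(2)]) (simp only: eq)
  qed
  show "sparse_paving_indeps {1..n} r ` stable_sets {1..n} r
      \<subseteq> {Ind. matroid {1..n} Ind \<and> sparse_paving {1..n} Ind}"
    using matroid_sparse_paving_indeps sparse_paving_sparse_paving_indeps by blast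
  have "{Ind. matroid {1..n} Ind \<and> sparse_paving {1..n} Ind} \<subseteq> Pow (Pow {1..n})"
    by (auto dest: matroid.indep_subset_ground)
  then show "finite {Ind. matroid {1..n} Ind \<and> sparse_paving {1..n} Ind}"
    by (rule finite_subset) simp
qed

text \<open>Exchanging one element changes the element sum by less than \<open>n\<close> in absolute value,
  so every residue class of sums is stable (Graham and Sloane).\<close>

lemma residue_class_stable:
  fixes n r j :: nat
  shows "johnson_stable r {X. X \<subseteq> {1..n} \<and> card X = r \<and> \<Sum>X mod n = j}"
  unfolding johnson_stable_def
proof (intro ballI notI)
  fix X Y assume X: "X \<in> {X. X \<subseteq> {1..n} \<and> card X = r \<and> \<Sum>X mod n = j}"
    and Y: "Y \<in> {X. X \<subseteq> {1..n} \<and> card X = r \<and> \<Sum>X mod n = j}"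
    and adj: "card (X \<inter> Y) + 1 = r"
  have sub: "X \<subseteq> {1..n}" "Y \<subseteq> {1..n}" using X Y by simp_all
  have fin: "finite X" "finite Y"
    using finite_subset[OF sub(1) finite_atLeastAtMost] finite_subset[OF sub(2) finite_atLeastAtMost] .
  have card: "card X = r" "card Y = r" using X Y by simp_all
  obtain x y where diff: "X - Y = {x}" "Y - X = {y}" and "card (X \<union> Y) = r + 1"
    by (rule adjacent_sets[OF fin(1) card(1) fin(2) card(2) adj])
  have "\<Sum>X = \<Sum>(X \<inter> Y) + x" "\<Sum>Y = \<Sum>(X \<inter> Y) + y"
    using sum.Int_Diff[OF fin(1), of "\<lambda>a. a" Y] sum.Int_Diff[OF fin(2), of "\<lambda>a. a" X] diff
    by (simp_all add: Int_commute)
  then have eq: "(\<Sum>(X \<inter> Y) + x) mod n = (\<Sum>(X \<inter> Y) + y) mod n" using X Y by simp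
  have xy: "x \<noteq> y" "x \<in> {1..n}" "y \<in> {1..n}" using diff sub by auto
  show False
  proof (cases "x < y")
    case True
    then have "n dvd y - x" using eq mod_eq_dvd_iff_nat[of "\<Sum>(X \<inter> Y) + x" "\<Sum>(X \<inter> Y) + y" n] by simp
    then show False using True xy by (auto dest!: dvd_imp_le)
  next
    case False
    then have "n dvd x - y" using eq mod_eq_dvd_iff_nat[of "\<Sum>(X \<inter> Y) + y" "\<Sum>(X \<inter> Y) + x" n] by simp
    then show False using False xy by (auto dest!: dvd_imp_le)
  qed
qed

text \<open>By pigeonhole some residue class of sums holds at least a fraction \<open>1 / n\<close>
  of the \<open>r\<close>-sets; \<open>m\<close> is its size, and all its subsets are
  stable.\<close>

lemma num_sparse_paving_ge:
  assumes n: "n \<ge> 2"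
  obtains m where "n choose (n div 2) \<le> n * m" "2 ^ m \<le> num_sparse_paving n"
proof -
  define r where "r = n div 2"
  have r: "0 < r" "r < n" using n unfolding r_def by auto
  define C where "C j = {X. X \<subseteq> {1..n} \<and> card X = r \<and> \<Sum>X mod n = j}" for j
  have finC: "finite (C j)" for j unfolding C_def by simp
  have "{X. X \<subseteq> {1..n} \<and> card X = r} = (\<Union>j<n. C j)" unfolding C_def using n by auto
  moreover have "card (\<Union>j<n. C j) = (\<Sum>j<n. card (C j))"
    using finC by (intro card_UN_disjoint) (auto simp: C_def)
  ultimately have total: "n choose r = (\<Sum>j<n. card (C j))"
    using n_subsets[of "{1..n}" r] by simp
  obtain j where j: "n choose r \<le> n * card (C j)"
  proof (rule ccontr)
    assume "\<not> thesis"
    then have "n * card (C j) < n choose r" for j using that by (meson not_le)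
    then have "(\<Sum>j<n. n * card (C j)) < (\<Sum>j<n. n choose r)"
      using n by (intro sum_strict_mono) (auto simp: lessThan_empty_iff)
    then show False using total by (simp add: sum_distrib_left[symmetric])
  qed
  have "Pow (C j) \<subseteq> stable_sets {1..n} r"
  proof
    fix V assume "V \<in> Pow (C j)"
    then have V: "V \<subseteq> C j" by simp
    then have st: "johnson_stable r V"
      using residue_class_stable[of r n j] unfolding C_def[symmetric] johnson_stable_def by blast
    \<comment> \<open>Two adjacent \<open>r\<close>-sets, available since \<open>0 < r < n\<close>,
      show that \<open>V\<close> is not the family of all \<open>r\<close>-sets.\<close>
    have "insert r {1..<r} \<notin> V \<or> insert (r + 1) {1..<r} \<notin> V"
      using not_both_in_stable[OF st, of "{1..<r}" r "r + 1"] r by simp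
    moreover have "insert r {1..<r} \<in> {X. X \<subseteq> {1..n} \<and> card X = r}"
      "insert (r + 1) {1..<r} \<in> {X. X \<subseteq> {1..n} \<and> card X = r}" using r by auto
    ultimately have "V \<noteq> {X. X \<subseteq> {1..n} \<and> card X = r}" by blast
    then show "V \<in> stable_sets {1..n} r" using V st unfolding stable_sets_def C_def by auto
  qed
  then have "card (Pow (C j)) \<le> card (stable_sets {1..n} r)"
    by (intro card_mono finite_stable_sets) auto
  also have "\<dots> \<le> num_sparse_paving n" by (rule card_stable_sets_le)
  finally show thesis using that[of "card (C j)"] j finC unfolding r_def by (simp add: card_Pow)
qed

section \<open>Counting codes\<close>

lemma card_subsets_card_less:
  assumes "n \<ge> 1"
  shows "card {A. A \<subseteq> {1..n} \<and> card A < k} \<le> k * n ^ k"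
proof -
  have "{A. A \<subseteq> {1..n} \<and> card A < k} = (\<Union>i<k. {A. A \<subseteq> {1..n} \<and> card A = i})" by auto
  then have "card {A. A \<subseteq> {1..n} \<and> card A < k} \<le> (\<Sum>i<k. card {A. A \<subseteq> {1..n} \<and> card A = i})"
    using card_UN_le[of "{..<k}"] by simp
  also have "\<dots> = (\<Sum>i<k. n choose i)" using n_subsets[of "{1..n}"] by simp
  also have "\<dots> \<le> (\<Sum>i<k. n ^ k)"
  proof (rule sum_mono)
    fix i assume i: "i \<in> {..<k}"
    have "n choose i \<le> n ^ i" using binomial_le_pow[of i n] by (cases "i \<le> n") (auto simp: binomial_eq_0)
    also have "\<dots> \<le> n ^ k" using i assms by (intro power_increasing) auto
    finally show "n choose i \<le> n ^ k" .
  qed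
  finally show ?thesis by simp
qed

text \<open>Give each family the weight \<open>x ^ card Z\<close>. The total over
  \<open>Pow U\<close> is \<open>(x + 1) ^ card U\<close>, and each family counted weighs at least
  \<open>x ^ z\<close>.\<close>

lemma card_small_families:
  fixes x :: real
  assumes U: "finite U" and x: "0 < x" "x \<le> 1"
  shows "real (card {Z. Z \<subseteq> U \<and> card Z \<le> z}) * x ^ z \<le> exp (x * card U)"
proof -
  let ?F = "{Z. Z \<subseteq> U \<and> card Z \<le> z}"
  have "real (card ?F) * x ^ z = (\<Sum>Z\<in>?F. x ^ z)" by simp
  also have "\<dots> \<le> (\<Sum>Z\<in>?F. x ^ card Z)" using x by (intro sum_mono power_decreasing) auto
  also have "\<dots> \<le> (\<Sum>Z\<in>Pow U. x ^ card Z)" using x U by (intro sum_mono2) auto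
  also have "\<dots> = (x + 1) ^ card U" using prod_add[OF U, of "\<lambda>_. x" "\<lambda>_. 1"] by simp
  also have "\<dots> \<le> exp x ^ card U"
    using x exp_ge_add_one_self[of x] by (intro power_mono) (auto simp: add.commute)
  also have "\<dots> = exp (x * card U)" by (simp add: exp_of_nat_mult[symmetric] mult.commute)
  finally show ?thesis .
qed

text \<open>This makes a matroid recoverable from its rank and nonbases.\<close>

lemma (in matroid) indep_iff_subset_basis:
  "I \<in> Ind \<longleftrightarrow> (\<exists>B. I \<subseteq> B \<and> B \<subseteq> E \<and> card B = matroid_rank Ind \<and> B \<notin> nonbases)"
proof
  assume I: "I \<in> Ind"
  obtain B where B: "B \<in> Ind" "card B = matroid_rank Ind" by (rule obtain_basis)
  then obtain K where K: "K \<in> Ind" "I \<subseteq> K" "card K = matroid_rank Ind"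
    using indep_extend[OF I B(1), of "matroid_rank Ind"] card_le_rank[OF I] by (metis order_refl)
  then show "\<exists>B. I \<subseteq> B \<and> B \<subseteq> E \<and> card B = matroid_rank Ind \<and> B \<notin> nonbases"
    using indep_subset_ground[OF K(1)] unfolding nonbases_def by (intro exI[of _ K]) simp
qed (auto simp: nonbases_def intro: indep_subset)

lemma matroid_eqI:
  assumes "matroid E I" "matroid E J" "matroid_rank I = matroid_rank J"
    and "matroid.nonbases E I = matroid.nonbases E J"
  shows "I = J"
  by (rule set_eqI) (simp only: matroid.indep_iff_subset_basis[OF assms(1)]
    matroid.indep_iff_subset_basis[OF assms(2)] assms(3,4))

text \<open>The central coefficient gives one bound for all ranks, hence also for the dual.\<close>

lemma card_rich_hyps_le:
  assumes "matroid {1..n} I" "k > 0"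
  shows "card (matroid.rich_hyps {1..n} I k) \<le> 4 * (n choose (n div 2)) div k\<^sup>2"
proof -
  have "card (matroid.rich_hyps {1..n} I k) * k\<^sup>2 \<le> 4 * (n choose (matroid_rank I - 1))"
    using matroid.card_rich_hyps[OF assms(1), of k] by simp
  also have "\<dots> \<le> 4 * (n choose (n div 2))" using binomial_maximum by simp
  finally show ?thesis using assms(2) by (simp add: less_eq_div_iff_mult_less_eq)
qed

lemma rich_hyps_subset_Pow:
  assumes "matroid E I"
  shows "matroid.rich_hyps E I k \<subseteq> Pow E"
  using matroid.rich_hyps_def[OF assms] matroid.spn_def[OF assms] by auto

text \<open>For fixed rank the nonbases determine the matroid and are decoded from a tuple in
  \<open>T\<close>. The squares account for the families of the matroid and of its dual.\<close>

lemma card_matroids_of_rank: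
  fixes n r k :: nat
  assumes k: "k > 0"
  defines "P \<equiv> card {A. A \<subseteq> {1..n} \<and> card A < k}"
    and "F \<equiv> card {Z. Z \<subseteq> Pow {1..n} \<and> card Z \<le> 4 * (n choose (n div 2)) div k\<^sup>2}"
  shows "card {I. matroid {1..n} I \<and> matroid_rank I = r}
    \<le> (2 ^ P)\<^sup>2 * F\<^sup>2 * num_sparse_paving n"
proof -
  define SP where "SP = Pow {A. A \<subseteq> {1..n} \<and> card A < k}"
  define FF where "FF = {Z. Z \<subseteq> Pow {1..n} \<and> card Z \<le> 4 * (n choose (n div 2)) div k\<^sup>2}"
  define T where "T = SP \<times> SP \<times> FF \<times> FF \<times> stable_sets {1..n} r"
  let ?M = "{I. matroid {1..n} I \<and> matroid_rank I = r}"
  have fin: "finite SP" "finite FF" "finite (stable_sets {1..n} r)"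
    unfolding SP_def FF_def by (simp_all add: finite_stable_sets)
  have finT: "finite T" unfolding T_def by (intro finite_cartesian_product fin)
  have "inj_on (matroid.nonbases {1..n}) ?M"
  proof (rule inj_onI)
    fix I J assume "I \<in> ?M" "J \<in> ?M" "matroid.nonbases {1..n} I = matroid.nonbases {1..n} J"
    then show "I = J" using matroid_eqI[of "{1..n}" I J] by simp
  qed
  moreover have "matroid.nonbases {1..n} ` ?M \<subseteq> decode {1..n} r ` T"
  proof
    fix K assume "K \<in> matroid.nonbases {1..n} ` ?M"
    then obtain I where I: "matroid {1..n} I" "matroid_rank I = r" "K = matroid.nonbases {1..n} I"
      by auto
    interpret matroid "{1..n}" I by (rule I)
    let ?D = "dual {1..n} I"
    interpret co: matroid "{1..n}" ?D by (rule matroid_dual)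
    obtain V where V: "V \<subseteq> nonbases" "johnson_stable r V"
      "nonbases = decode {1..n} r (small_deps k, co.small_deps k, rich_hyps k, co.rich_hyps k, V)"
      using ex_stable_decode[of k] I(2) by auto
    obtain B where "B \<in> I" "card B = r" using obtain_basis I(2) by auto
    then have "B \<in> {X. X \<subseteq> {1..n} \<and> card X = r}" "B \<notin> nonbases"
      using indep_subset_ground unfolding nonbases_def by auto
    moreover have "nonbases \<subseteq> {X. X \<subseteq> {1..n} \<and> card X = r}"
      using I(2) unfolding nonbases_def by auto
    ultimately have "V \<in> stable_sets {1..n} r" using V(1,2) unfolding stable_sets_def by auto
    moreover have "small_deps k \<in> SP" "co.small_deps k \<in> SP"
      unfolding SP_def small_deps_def co.small_deps_def by auto
    moreover have "rich_hyps k \<in> FF" "co.rich_hyps k \<in> FF"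
      unfolding FF_def using card_rich_hyps_le k I(1) matroid_dual rich_hyps_subset_Pow by simp_all
    ultimately have "(small_deps k, co.small_deps k, rich_hyps k, co.rich_hyps k, V) \<in> T"
      unfolding T_def by simp
    then show "K \<in> decode {1..n} r ` T" using V(3) I(3) by blast
  qed
  ultimately have "card ?M \<le> card (decode {1..n} r ` T)"
    by (rule card_inj_on_le) (simp add: finT)
  also have "\<dots> \<le> card T" by (rule card_image_le[OF finT])
  also have "\<dots> = (2 ^ P)\<^sup>2 * F\<^sup>2 * card (stable_sets {1..n} r)"
    unfolding T_def P_def F_def SP_def FF_def
    by (simp add: card_cartesian_product card_Pow power2_eq_square)
  also have "\<dots> \<le> (2 ^ P)\<^sup>2 * F\<^sup>2 * num_sparse_paving n" using card_stable_sets_le by simp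
  finally show ?thesis .
qed

lemma num_loopless_coloopless_le:
  assumes k: "k > 0"
  shows "num_loopless_coloopless n \<le> (n + 1) * ((2 ^ card {A. A \<subseteq> {1..n} \<and> card A < k})\<^sup>2 *
    (card {Z. Z \<subseteq> Pow {1..n} \<and> card Z \<le> 4 * (n choose (n div 2)) div k\<^sup>2})\<^sup>2 *
    num_sparse_paving n)" (is "_ \<le> _ * ?b")
proof -
  let ?M = "\<lambda>r. {I. matroid {1..n} I \<and> matroid_rank I = r}"
  have sub: "{I. matroid {1..n} I} \<subseteq> Pow (Pow {1..n})"
    by (auto dest: matroid.indep_subset_ground)
  have fin: "finite (?M r)" for r
    by (rule finite_subset[of _ "Pow (Pow {1..n})"]) (use sub in auto)
  have "{I. matroid {1..n} I \<and> (\<nexists>e. is_loop {1..n} I e) \<and> (\<nexists>e. is_coloop {1..n} I e)}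
    \<subseteq> (\<Union>r\<le>n. ?M r)"
    using matroid.rank_le_card by fastforce
  then have "num_loopless_coloopless n \<le> card (\<Union>r\<le>n. ?M r)"
    unfolding num_loopless_coloopless_def using fin by (intro card_mono) auto
  also have "\<dots> \<le> (\<Sum>r\<le>n. card (?M r))" by (intro card_UN_le) auto
  also have "\<dots> \<le> (\<Sum>r\<le>n. ?b)" using card_matroids_of_rank[OF k] by (intro sum_mono) simp
  finally show ?thesis by simp
qed

section \<open>Asymptotics\<close>

lemma pow2_le_central_binomial: "2 ^ n \<le> (n + 1) * (n choose (n div 2))"
proof -
  have "2 ^ n = (\<Sum>i\<le>n. n choose i)" by (rule choose_row_sum[symmetric])
  also have "\<dots> \<le> (\<Sum>i\<le>n. n choose (n div 2))" by (intro sum_mono binomial_maximum)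
  finally show ?thesis by simp
qed

lemma card_families_pos: "card {Z. Z \<subseteq> Pow {1..n::nat} \<and> card Z \<le> z} > 0"
proof -
  have "{} \<in> {Z. Z \<subseteq> Pow {1..n} \<and> card Z \<le> z}" by simp
  moreover have "finite {Z. Z \<subseteq> Pow {1..n} \<and> card Z \<le> z}" by simp
  ultimately show ?thesis using card_gt_0_iff by blast
qed

text \<open>With weight \<open>x = 1 / n ^ 3\<close> each member costs \<open>3 * ln n\<close>, and
  the overhead \<open>2 ^ n / n ^ 3\<close> is still \<open>o(N / n)\<close> under the crude
  estimate \<open>N \<ge> 2 ^ n / (n + 1)\<close>.\<close>

lemma ln_card_small_families:
  assumes n: "n \<ge> 1"
  shows "ln (card {Z. Z \<subseteq> Pow {1..n} \<and> card Z \<le> z}) \<le> 2 ^ n / real n ^ 3 + 3 * z * ln n"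
proof -
  define c where "c = real (card {Z. Z \<subseteq> Pow {1..n} \<and> card Z \<le> z})"
  have c: "c > 0" unfolding c_def using card_families_pos by simp
  have "c * (1 / real n ^ 3) ^ z \<le> exp (1 / real n ^ 3 * card (Pow {1..n}))"
    unfolding c_def using n by (intro card_small_families) auto
  moreover have "0 < c * (1 / real n ^ 3) ^ z" using c n by simp
  ultimately have "ln (c * (1 / real n ^ 3) ^ z) \<le> ln (exp (1 / real n ^ 3 * card (Pow {1..n})))"
    by (simp only: ln_le_cancel_iff[OF _ exp_gt_zero])
  then have "ln (c * (1 / real n ^ 3) ^ z) \<le> 2 ^ n / real n ^ 3" by (simp add: card_Pow)
  moreover have "ln (c * (1 / real n ^ 3) ^ z) = ln c - 3 * z * ln n"
    using c n by (simp add: ln_mult ln_realpow ln_div)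
  ultimately show ?thesis unfolding c_def by simp
qed

text \<open>The extra bits in units of \<open>N / n\<close>, with \<open>n / N\<close> bounded by
  \<open>n * (n + 1) / 2 powr n\<close>. The last summand is the cost of the hyperplanes; the first
  covers the rank, the small dependent sets and the overhead of the hyperplane families.\<close>

definition error_term :: "nat \<Rightarrow> real" where
  "error_term n = n * (n + 1) / 2 powr n * (log 2 (n + 1) +
     2 * ((n powr (3/4) + 1) * n powr (n powr (3/4) + 1)) + 4 * (2 powr n / n ^ 3)) +
     48 * (n * ln n / n powr (3/2))"

lemma error_term_tendsto: "error_term \<longlonglongrightarrow> 0"
  unfolding error_term_def by real_asymp

lemma log_num_loopless_coloopless_le:
  assumes n: "n \<ge> 2"
  shows "log 2 (num_loopless_coloopless n) \<le> (1 + error_term n) * log 2 (num_sparse_paving n)"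
proof -
  \<comment> \<open>An exponent strictly between 1/2 and 1 keeps \<open>k * n ^ k\<close> negligible
    against \<open>2 ^ n / n ^ 2\<close>, while \<open>k ^ 2\<close> outgrows
    \<open>n * ln n\<close>.\<close>
  define k where "k = nat \<lceil>real n powr (3/4)\<rceil>"
  define N where "N = n choose (n div 2)"
  define P where "P = card {A. A \<subseteq> {1..n} \<and> card A < k}"
  define z where "z = 4 * N div k\<^sup>2"
  define F where "F = card {Z. Z \<subseteq> Pow {1..n} \<and> card Z \<le> z}"
  define p where "p = (n powr (3/4) + 1) * n powr (n powr (3/4) + 1)"
  define q where "q = 2 powr n / real n ^ 3"
  define w where "w = n * ln n / n powr (3/2)"
  define A where "A = log 2 (n + 1) + 2 * p + 4 * q"
  define L where "L = log 2 (num_sparse_paving n)"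
  have kge: "real n powr (3/4) \<le> k" unfolding k_def by linarith
  have kle: "real k \<le> real n powr (3/4) + 1" unfolding k_def by simp
  have "0 < real n powr (3/4)" using n by simp
  then have k: "k > 0" using kge by linarith
  have A0: "A \<ge> 0" and w0: "w \<ge> 0" unfolding A_def p_def q_def w_def using n by simp_all
  obtain m where m: "N \<le> n * m" "2 ^ m \<le> num_sparse_paving n"
    using num_sparse_paving_ge[OF n] unfolding N_def by blast
  have s: "0 < num_sparse_paving n" using m(2) by (rule less_le_trans[rotated]) simp
  have "real m = log 2 (2 ^ m)" by simp
  also have "\<dots> \<le> L" unfolding L_def using m(2) s
    by (subst log_le_cancel_iff) (auto simp: numeral_power_le_of_nat_cancel_iff)
  finally have mL: "real m \<le> L" .
  have "real N \<le> n * real m" using m(1) by (metis of_nat_le_iff of_nat_mult)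
  also have "\<dots> \<le> n * L" using mL by (intro mult_left_mono) auto
  finally have NL: "real N / n \<le> L" using n by (simp add: field_simps)
  have "real (2 ^ n) \<le> real ((n + 1) * N)"
    using pow2_le_central_binomial[of n] unfolding N_def of_nat_le_iff .
  then have twoN: "2 powr n \<le> (n + 1) * real N" by (simp add: powr_realpow algebra_simps)
  have P: "real P \<le> p"
  proof -
    have "P \<le> k * n ^ k" unfolding P_def using card_subsets_card_less[of n k] n by simp
    then have "real P \<le> real (k * n ^ k)" by (rule of_nat_mono)
    also have "\<dots> = k * n powr k" using n by (simp add: powr_realpow)
    also have "\<dots> \<le> p"
      using kle n unfolding p_def by (intro mult_mono powr_mono) auto
    finally show ?thesis .
  qed
  have z: "real z \<le> 4 * N / n powr (3/2)"
  proof -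
    have "real z \<le> real (4 * N) / real (k\<^sup>2)" unfolding z_def by (rule of_nat_div_le_of_nat)
    also have "\<dots> \<le> real (4 * N) / n powr (3/2)"
    proof (rule divide_left_mono)
      have "n powr (3/2) = (n powr (3/4))\<^sup>2" using n by (simp add: powr_realpow[symmetric] powr_powr)
      also have "\<dots> \<le> (real k)\<^sup>2" using kge by (intro power_mono) auto
      finally show "n powr (3/2) \<le> real (k\<^sup>2)" by simp
    qed (use n k in auto)
    finally show ?thesis by simp
  qed
  have Fpos: "F > 0" unfolding F_def by (rule card_families_pos)
  have F: "log 2 F \<le> 2 * q + 24 * (w * (N / n))"
  proof -
    define b where "b = 2 ^ n / real n ^ 3 + 3 * z * ln n"
    \<comment> \<open>Changing to base 2 costs at most a factor 2.\<close>
    have "ln 2 \<ge> (1/2 :: real)" using ln_le_minus_one[of "1/2 :: real"] by (simp add: ln_div)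
    moreover have "b \<ge> 0" unfolding b_def using n by simp
    ultimately have "2 * b * (1/2) \<le> 2 * b * ln 2" by (intro mult_left_mono) auto
    moreover have "ln F \<le> b" unfolding F_def b_def using ln_card_small_families[of n z] n by simp
    ultimately have "ln F \<le> 2 * b * ln 2" by linarith
    then have "log 2 F \<le> 2 * b" by (simp add: log_def divide_le_eq)
    also have "\<dots> = 2 * q + real z * (6 * ln n)"
      unfolding b_def q_def using n by (simp add: powr_realpow)
    also have "real z * (6 * ln n) \<le> 4 * N / n powr (3/2) * (6 * ln n)"
      using z n by (intro mult_right_mono) auto
    also have "\<dots> = 24 * (w * (N / n))" unfolding w_def using n by simp
    finally show ?thesis by simp
  qed
  have "log 2 (num_loopless_coloopless n) \<le> log 2 (n + 1) + 2 * P + 2 * log 2 F + L"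
  proof (cases "num_loopless_coloopless n = 0")
    case True
    \<comment> \<open>Here \<open>log 2 0\<close> has the value \<open>0\<close>, so it suffices
      that the right side is nonnegative.\<close>
    have "log 2 (real F) \<ge> 0" "L \<ge> 0" "log 2 (real (n + 1)) \<ge> 0"
      using Fpos s unfolding L_def by simp_all
    moreover have "log 2 (num_loopless_coloopless n) = 0" using True by (simp add: log_def)
    ultimately show ?thesis by simp
  next
    case False
    let ?b = "(n + 1) * ((2 ^ P)\<^sup>2 * F\<^sup>2 * num_sparse_paving n)"
    have "num_loopless_coloopless n \<le> ?b"
      using num_loopless_coloopless_le[OF k, of n] unfolding P_def F_def z_def N_def .
    then have "log 2 (num_loopless_coloopless n) \<le> log 2 (real ?b)"
      using False by (subst log_le_cancel_iff) (auto simp del: of_nat_mult)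
    also have "\<dots> = log 2 (n + 1) + 2 * P + 2 * log 2 F + L"
    proof -
      have "log 2 (a * ((2 ^ P)\<^sup>2 * f\<^sup>2 * t)) = log 2 a + 2 * P + 2 * log 2 f + log 2 t"
        if "a > 0" "f > 0" "t > 0" for a f t :: real
        using that by (simp add: log_mult log_nat_power flip: power_mult)
      from this[of "real (n + 1)" F "num_sparse_paving n"] show ?thesis
        using Fpos s unfolding L_def by (simp only: of_nat_mult of_nat_power of_nat_0_less_iff) simp
    qed
    finally show ?thesis .
  qed
  also have "\<dots> \<le> A + 48 * (w * (N / n)) + L"
    using P F unfolding A_def by linarith
  finally have bound: "log 2 (num_loopless_coloopless n) \<le> A + 48 * (w * (N / n)) + L" .
  \<comment> \<open>Multiplying \<open>A\<close> by this factor expresses it in units of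
    \<open>N / n\<close>.\<close>
  have "1 \<le> (n + 1) * real N / 2 powr n" using twoN by simp
  then have "A * 1 \<le> A * ((n + 1) * real N / 2 powr n)" using A0 by (rule mult_left_mono)
  also have "\<dots> = n * (n + 1) / 2 powr n * A * (N / n)" using n by (simp add: field_simps)
  finally have A_le: "A \<le> n * (n + 1) / 2 powr n * A * (N / n)" by simp
  have err: "error_term n = n * (n + 1) / 2 powr n * A + 48 * w"
    unfolding error_term_def A_def p_def q_def w_def by (simp add: algebra_simps)
  have "A + 48 * (w * (N / n)) \<le> error_term n * (N / n)"
    using A_le unfolding err by (simp only: distrib_right mult.assoc)
  also have "\<dots> \<le> error_term n * L"
    using NL A0 w0 unfolding err by (intro mult_left_mono) auto
  finally show ?thesis using bound unfolding L_def by (simp add: distrib_right)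
qed

theorem theorem9:
  "\<exists>\<epsilon> :: nat \<Rightarrow> real. \<epsilon> \<in> o(\<lambda>_. 1) \<and>
     (\<forall>\<^sub>F n in sequentially.
        log 2 (real (num_loopless_coloopless n)) \<le> (1 + \<epsilon> n) * log 2 (real (num_sparse_paving n)))"
proof (intro exI conjI)
  show "error_term \<in> o(\<lambda>_. 1)" using error_term_tendsto by (intro smalloI_tendsto) auto
  show "\<forall>\<^sub>F n in sequentially.
      log 2 (real (num_loopless_coloopless n)) \<le> (1 + error_term n) * log 2 (real (num_sparse_paving n))"
    using eventually_ge_at_top[of 2] by eventually_elim (rule log_num_loopless_coloopless_le)
qed

end
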